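(* Let $\mathbb{F}$ be a field of characteristic not $2$, $G$ any group, and let the algebra $UT_n=UT_n(\mathbb{F})$ of upper triangular $n\times n$ matrices be endowed with the $G$-grading determined by $\eta=(g_1,g_2,\ldots,g_{n-1})\in G^{n-1}$. Then $(UT_n,\eta)$ admits a degree-inverting involution if and only if $g_i=g_{n-i}^{-1}$ for all $i=1,2,\ldots,n-1$. In this case, every degree-inverting involution on $(UT_n,\eta)$ is equivalent either to $\tau$ or to $s$, where $s$ can occur if and only if $n$ is even.
   Context: The $G$-grading on $UT_n$ determined by $\eta=(g_1,\ldots,g_{n-1})$ is the one in which every matrix unit $e_{ij}$ ($i\le j$) is homogeneous and $\deg e_{i,i+1}=g_i$; thus $\deg e_{ii}=1$ and $\deg e_{ij}=g_ig_{i+1}\cdots g_{j-1}$ for $i<j$. An involution is an $\mathbb{F}$-linear anti-automorphism $\rho$ with $\rho^2=1$. It is degree-inverting if $\rho(\mathcal{A}_g)\subseteq\mathcal{A}_{g^{-1}}$ for all $g\in G$, where $\mathcal{A}_g$ are the homogeneous components. Two degree-inverting involutions $\rho,\rho'$ are equivalent if there is a graded (degree-preserving) algebra automorphism $\varphi$ with $\varphi\circ\rho=\rho'\circ\varphi$. $\tau$ is the canonical involution $\tau(e_{ij})=e_{n-j+1,n-i+1}$ (the flip along the secondary diagonal). For $n=2m$ even, the symplectic involution is $s(x)=D\tau(x)D$, where $D=\mathrm{diag}(1,\ldots,1,-1,\ldots,-1)$ with $m$ entries equal to $1$ followed by $m$ entries equal to $-1$. *)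

theory Defs
  imports "Jordan_Normal_Form.Matrix" "HOL-Algebra.Group"
begin

text \<open>Rows and columns of type \<open>mat\<close> are numbered from 0. The grading tuple \<open>\<eta>\<close>, the matrix
  units and the degrees below are numbered from 1, so that entry \<open>(r, c)\<close> of a matrix
  is the coefficient of the matrix unit with indices \<open>Suc r\<close> and \<open>Suc c\<close>.\<close>

definition UT :: "nat \<Rightarrow> 'a::zero mat set" where
  "UT n = {A \<in> carrier_mat n n. upper_triangular A}"

definition mat_unit :: "nat \<Rightarrow> nat \<Rightarrow> nat \<Rightarrow> 'a::zero_neq_one mat" where
  "mat_unit n i j = mat n n (\<lambda>(r, c). if Suc r = i \<and> Suc c = j then 1 else 0)"

text \<open>The ordered product \<open>\<eta> i \<otimes> \<eta> (i + 1) \<otimes> \<dots> \<otimes> \<eta> (j - 1)\<close>, which is \<open>\<one>\<close> for \<open>i = j\<close>.\<close>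

definition unit_degree :: "('g, 'm) monoid_scheme \<Rightarrow> (nat \<Rightarrow> 'g) \<Rightarrow> nat \<Rightarrow> nat \<Rightarrow> 'g" where
  "unit_degree G \<eta> i j = foldr (\<lambda>k x. \<eta> k \<otimes>\<^bsub>G\<^esub> x) [i..<j] \<one>\<^bsub>G\<^esub>"

text \<open>The linear span of the upper triangular matrix units of degree \<open>g\<close>: upper triangular
  matrices whose nonzero entries all sit in positions of degree \<open>g\<close>.\<close>

definition homogeneous_component ::
  "('g, 'm) monoid_scheme \<Rightarrow> nat \<Rightarrow> (nat \<Rightarrow> 'g) \<Rightarrow> 'g \<Rightarrow> 'a::zero mat set" where
  "homogeneous_component G n \<eta> g =
     {A \<in> UT n. \<forall>r<n. \<forall>c<n. A $$ (r, c) \<noteq> 0 \<longrightarrow> unit_degree G \<eta> (Suc r) (Suc c) = g}"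

text \<open>Maps on the algebra are functions on the whole matrix type of which only the values on
  \<open>UT n\<close> matter.\<close>

definition UT_linear_bij :: "nat \<Rightarrow> ('a::field mat \<Rightarrow> 'a mat) \<Rightarrow> bool" where
  "UT_linear_bij n f \<longleftrightarrow>
     bij_betw f (UT n) (UT n) \<and>
     (\<forall>A\<in>UT n. \<forall>B\<in>UT n. f (A + B) = f A + f B) \<and>
     (\<forall>a. \<forall>A\<in>UT n. f (a \<cdot>\<^sub>m A) = a \<cdot>\<^sub>m f A)"

definition UT_automorphism :: "nat \<Rightarrow> ('a::field mat \<Rightarrow> 'a mat) \<Rightarrow> bool" where
  "UT_automorphism n f \<longleftrightarrow>
     UT_linear_bij n f \<and> (\<forall>A\<in>UT n. \<forall>B\<in>UT n. f (A * B) = f A * f B)"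

definition UT_antiautomorphism :: "nat \<Rightarrow> ('a::field mat \<Rightarrow> 'a mat) \<Rightarrow> bool" where
  "UT_antiautomorphism n f \<longleftrightarrow>
     UT_linear_bij n f \<and> (\<forall>A\<in>UT n. \<forall>B\<in>UT n. f (A * B) = f B * f A)"

definition UT_involution :: "nat \<Rightarrow> ('a::field mat \<Rightarrow> 'a mat) \<Rightarrow> bool" where
  "UT_involution n \<rho> \<longleftrightarrow> UT_antiautomorphism n \<rho> \<and> (\<forall>A\<in>UT n. \<rho> (\<rho> A) = A)"

definition degree_inverting_involution ::
  "('g, 'm) monoid_scheme \<Rightarrow> nat \<Rightarrow> (nat \<Rightarrow> 'g) \<Rightarrow> ('a::field mat \<Rightarrow> 'a mat) \<Rightarrow> bool" where
  "degree_inverting_involution G n \<eta> \<rho> \<longleftrightarrow>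
     UT_involution n \<rho> \<and>
     (\<forall>g\<in>carrier G. \<rho> ` homogeneous_component G n \<eta> g
                      \<subseteq> homogeneous_component G n \<eta> (inv\<^bsub>G\<^esub> g))"

definition graded_automorphism ::
  "('g, 'm) monoid_scheme \<Rightarrow> nat \<Rightarrow> (nat \<Rightarrow> 'g) \<Rightarrow> ('a::field mat \<Rightarrow> 'a mat) \<Rightarrow> bool" where
  "graded_automorphism G n \<eta> \<phi> \<longleftrightarrow>
     UT_automorphism n \<phi> \<and>
     (\<forall>g\<in>carrier G. \<phi> ` homogeneous_component G n \<eta> g \<subseteq> homogeneous_component G n \<eta> g)"

definition equivalent_involutions ::
  "('g, 'm) monoid_scheme \<Rightarrow> nat \<Rightarrow> (nat \<Rightarrow> 'g) \<Rightarrow>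
     ('a::field mat \<Rightarrow> 'a mat) \<Rightarrow> ('a mat \<Rightarrow> 'a mat) \<Rightarrow> bool" where
  "equivalent_involutions G n \<eta> \<rho> \<rho>' \<longleftrightarrow>
     (\<exists>\<phi>. graded_automorphism G n \<eta> \<phi> \<and> (\<forall>A\<in>UT n. \<phi> (\<rho> A) = \<rho>' (\<phi> A)))"

definition canonical_involution :: "nat \<Rightarrow> 'a mat \<Rightarrow> 'a mat" where
  "canonical_involution n A = mat n n (\<lambda>(r, c). A $$ (n - 1 - c, n - 1 - r))"

text \<open>The argument is half the size of the matrices, so this acts on \<open>UT (2 * m)\<close>.\<close>

definition symplectic_involution :: "nat \<Rightarrow> 'a::field mat \<Rightarrow> 'a mat" where
  "symplectic_involution m A =
     (let D = mat_diag (2 * m) (\<lambda>i. if i < m then 1 else - 1)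
      in D * canonical_involution (2 * m) A * D)"

lemma canonical_involution_mat_unit:
  assumes "i \<in> {1..n}" "j \<in> {1..n}"
  shows "canonical_involution n (mat_unit n i j) = mat_unit n (n - j + 1) (n - i + 1)"
  by (rule eq_matI) (use assms in \<open>auto simp: canonical_involution_def mat_unit_def\<close>)

lemma mat_unit_homogeneous:
  assumes "1 \<le> i" "i \<le> j" "j \<le> n"
  shows "mat_unit n i j \<in> homogeneous_component G n \<eta> (unit_degree G \<eta> i j)"
  using assms
  by (auto simp: homogeneous_component_def UT_def mat_unit_def upper_triangular_def)

lemma unit_degree_refl: "unit_degree G \<eta> i i = \<one>\<^bsub>G\<^esub>"
  by (simp add: unit_degree_def)

lemma (in monoid) unit_degree_Suc:
  "\<eta> i \<in> carrier G \<Longrightarrow> unit_degree G \<eta> i (Suc i) = \<eta> i"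
  by (simp add: unit_degree_def)

end

theory Submission
  imports Defs "Jordan_Normal_Form.Determinant"
begin

text \<open>
  An involution \<open>\<rho>\<close> of \<open>UT n\<close> is the adjoint map of a bilinear form. For \<open>x\<close> and \<open>y\<close> in the space
  \<open>V\<close> of matrices that vanish outside their last column, let \<open>B(x, y)\<close> be the upper right corner
  entry of \<open>\<rho> x * y\<close>. Then \<open>B(a * x, y) = B(x, \<rho> a * y)\<close> for all \<open>a\<close>. The corner matrix unit spans
  the only one-dimensional two-sided ideal, so \<open>\<rho>\<close> multiplies it by a scalar \<open>\<epsilon>\<close>, and
  \<open>\<epsilon>\<^sup>2 = 1\<close> since \<open>\<rho>\<close> is an involution. Applying \<open>\<rho>\<close> to a product whose corner entry is \<open>B(x, y)\<close>
  gives \<open>B(y, x) = \<epsilon> * B(x, y)\<close>: the form is symmetric or skew.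

  Let \<open>U\<close> be the Gram matrix of \<open>B\<close> for the matrix units of the last column, with the
  rows in reverse order, and write \<open>\<tau>\<close> for the flip. Adjointness and the symmetry of \<open>B\<close> become
  \<open>U * \<rho> A = \<tau> A * U\<close> and \<open>\<tau> U = \<epsilon> U\<close> (lemmas \<open>gram_image\<close> and \<open>flip_gram\<close>). The form is
  nondegenerate because the images of the first row of matrix units provide an inverse of \<open>U\<close>.
  Moreover \<open>\<rho>\<close> maps a matrix unit off the diagonal, which has square zero, to a strictly upper
  triangular matrix; as every matrix unit is a product of superdiagonal ones, this makes \<open>U\<close> and
  its inverse upper triangular.

  Let \<open>\<rho>\<close> invert degrees. Comparing superdiagonal entries in \<open>U * \<rho> A = \<tau> A * U\<close> for a
  superdiagonal matrix unit \<open>A\<close> forces the stated symmetry of \<open>\<eta>\<close>. Given that symmetry, the entries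
  of \<open>U\<close> and of its inverse sit in positions of degree \<open>\<one>\<close>.

  It remains to bring \<open>U\<close> into normal form. Let \<open>S\<close> be the diagonal matrix with entries
  \<open>1\<close>, except for \<open>\<epsilon>\<close> in the last \<open>n div 2\<close> places. For odd \<open>n\<close> the middle entry of \<open>U\<close> is
  nonzero and fixed by \<open>\<tau>\<close>, so \<open>\<epsilon> = 1\<close>; since \<open>U\<close> matters only up to a scalar, this entry may be
  taken to be \<open>1\<close>. Then \<open>U = \<tau> N * S * N\<close>, where \<open>N\<close> consists of
  the upper half of \<open>U\<close> with its right-hand block divided by \<open>2\<close>, completed by rows of the identity
  (lemma \<open>half_factor_product\<close>). Conjugation by \<open>N\<close> is a graded automorphism that carries \<open>\<rho>\<close> to
  \<open>x \<mapsto> S * \<tau> x * S\<close>, which is the flip for \<open>\<epsilon> = 1\<close> and the symplectic involution for \<open>\<epsilon> = -1\<close>.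
  The two are not equivalent, because every automorphism scales the corner matrix unit and
  therefore preserves \<open>\<epsilon>\<close>.
\<close>

(* Keeps n - 1 in one form, so that facts about the last index match. *)
declare One_nat_def [simp del]

section \<open>Upper triangular matrices and matrix units\<close>

lemma UT_iff:
  "A \<in> UT n \<longleftrightarrow> A \<in> carrier_mat n n \<and> (\<forall>i<n. \<forall>j<i. A $$ (i, j) = 0)"
  by (auto simp: UT_def upper_triangular_def)

lemma UT_carrier: "A \<in> UT n \<Longrightarrow> A \<in> carrier_mat n n"
  by (simp add: UT_def)

lemma UT_lower_entry: "A \<in> UT n \<Longrightarrow> i < n \<Longrightarrow> j < i \<Longrightarrow> A $$ (i, j) = 0"
  by (simp add: UT_iff)

lemma mult_entry:
  assumes "A \<in> carrier_mat n n" "B \<in> carrier_mat n n" "i < n" "j < n"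
  shows "(A * B) $$ (i, j) = (\<Sum>p<n. A $$ (i, p) * B $$ (p, j))"
  using assms by (auto simp: scalar_prod_def lessThan_atLeast0)

lemma square_mat_eqI:
  assumes "A \<in> carrier_mat n n" "B \<in> carrier_mat n n"
    "\<And>i j. i < n \<Longrightarrow> j < n \<Longrightarrow> A $$ (i, j) = B $$ (i, j)"
  shows "A = B"
  using assms by (intro eq_matI) auto

lemma smult_smult_mat:
  fixes A :: "'a::semigroup_mult mat"
  shows "a \<cdot>\<^sub>m (b \<cdot>\<^sub>m A) = (a * b) \<cdot>\<^sub>m A"
  by (intro eq_matI) (auto simp: mult.assoc)

lemma one_smult_mat:
  fixes A :: "'a::monoid_mult mat"
  shows "1 \<cdot>\<^sub>m A = A"
  by (intro eq_matI) auto

lemma zero_smult_mat: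
  fixes A :: "'a::mult_zero mat"
  assumes "A \<in> carrier_mat n n"
  shows "0 \<cdot>\<^sub>m A = 0\<^sub>m n n"
  using assms by (intro eq_matI) auto

lemma UT_mult_nonzero_between:
  fixes A B :: "'a::semiring_0 mat"
  assumes "A \<in> UT n" "B \<in> UT n" "i < n" "j < n" "(A * B) $$ (i, j) \<noteq> 0"
  obtains p where "i \<le> p" "p \<le> j" "A $$ (i, p) \<noteq> 0" "B $$ (p, j) \<noteq> 0"
proof -
  have "(\<Sum>p<n. A $$ (i, p) * B $$ (p, j)) \<noteq> 0"
    using assms by (simp add: mult_entry[OF UT_carrier UT_carrier] del: index_mult_mat(1))
  then obtain p where p: "p < n" "A $$ (i, p) * B $$ (p, j) \<noteq> 0"
    by (auto elim: sum.not_neutral_contains_not_neutral)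
  then have ne: "A $$ (i, p) \<noteq> 0" "B $$ (p, j) \<noteq> 0"
    by auto
  show ?thesis
    using that[OF _ _ ne] ne p assms UT_lower_entry[of A n i p] UT_lower_entry[of B n p j]
    by (meson not_le)
qed

lemma UT_mult:
  fixes A B :: "'a::semiring_0 mat"
  assumes "A \<in> UT n" "B \<in> UT n"
  shows "A * B \<in> UT n"
proof -
  have "(A * B) $$ (i, j) = 0" if "i < n" "j < i" for i j
  proof (rule ccontr)
    assume "(A * B) $$ (i, j) \<noteq> 0"
    from UT_mult_nonzero_between[OF assms \<open>i < n\<close> _ this] that show False
      by (metis leD le_trans less_trans)
  qed
  then show ?thesis
    using assms mult_carrier_mat[of A n n B n] by (simp add: UT_iff del: index_mult_mat(1))
qed

lemma UT_one: "1\<^sub>m n \<in> UT n"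
  by (simp add: UT_def)

lemma UT_mult_diag:
  fixes A B :: "'a::semiring_0 mat"
  assumes "A \<in> UT n" "B \<in> UT n" "i < n"
  shows "(A * B) $$ (i, i) = A $$ (i, i) * B $$ (i, i)"
proof -
  have "A $$ (i, p) * B $$ (p, i) = 0" if "p < n" "p \<noteq> i" for p
    using that assms UT_lower_entry[of A n i p] UT_lower_entry[of B n p i] by (cases "p < i") auto
  then have "(\<Sum>p<n. A $$ (i, p) * B $$ (p, i))
      = (\<Sum>p<n. if p = i then A $$ (i, i) * B $$ (i, i) else 0)"
    by (intro sum.cong) auto
  then show ?thesis
    using assms by (simp add: mult_entry[OF UT_carrier UT_carrier] del: index_mult_mat(1))
qed

lemma mult_assoc_square:
  fixes A B C :: "'a::semiring_0 mat"
  assumes "A \<in> carrier_mat n n" "B \<in> carrier_mat n n" "C \<in> carrier_mat n n"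
  shows "A * B * C = A * (B * C)"
  using assms by (rule assoc_mult_mat)

lemma mult_carrier_square:
  "A \<in> carrier_mat n n \<Longrightarrow> B \<in> carrier_mat n n \<Longrightarrow> A * B \<in> carrier_mat n n"
  by simp

lemma mult_cancel_inverse:
  fixes A B X :: "'a::semiring_1 mat"
  assumes "A * B = 1\<^sub>m n" "A \<in> carrier_mat n n" "B \<in> carrier_mat n n" "X \<in> carrier_mat n n"
  shows "A * (B * X) = X"
  using assms by (simp flip: mult_assoc_square)

text \<open>Numbered from 0, as matrix entries are.\<close>

definition E :: "nat \<Rightarrow> nat \<Rightarrow> nat \<Rightarrow> 'a::zero_neq_one mat" where
  "E n i j = mat_unit n (Suc i) (Suc j)"

lemma E_carrier [simp]: "E n i j \<in> carrier_mat n n"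
  by (simp add: E_def mat_unit_def)

lemma E_dim [simp]: "dim_row (E n i j) = n" "dim_col (E n i j) = n"
  by (simp_all add: E_def mat_unit_def)

lemma E_entry: "r < n \<Longrightarrow> c < n \<Longrightarrow> E n i j $$ (r, c) = (if r = i \<and> c = j then 1 else 0)"
  by (simp add: E_def mat_unit_def)

lemma E_UT: "i \<le> j \<Longrightarrow> E n i j \<in> UT n"
  by (auto simp: UT_iff E_entry)

lemma E_mult_entry:
  fixes A :: "'a::semiring_1 mat"
  assumes "A \<in> carrier_mat n n" "r < n" "c < n" "j < n"
  shows "(E n i j * A) $$ (r, c) = (if r = i then A $$ (j, c) else 0)"
proof -
  have "(\<Sum>p<n. E n i j $$ (r, p) * A $$ (p, c))
      = (\<Sum>p<n. if p = j then (if r = i then A $$ (j, c) else 0) else 0)"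
    using assms by (intro sum.cong) (auto simp: E_entry)
  then show ?thesis
    using assms by (simp add: mult_entry[of _ n] del: index_mult_mat(1))
qed

lemma mult_E_entry:
  fixes A :: "'a::semiring_1 mat"
  assumes "A \<in> carrier_mat n n" "r < n" "c < n" "i < n"
  shows "(A * E n i j) $$ (r, c) = (if c = j then A $$ (r, i) else 0)"
proof -
  have "(\<Sum>p<n. A $$ (r, p) * E n i j $$ (p, c))
      = (\<Sum>p<n. if p = i then (if c = j then A $$ (r, i) else 0) else 0)"
    using assms by (intro sum.cong) (auto simp: E_entry)
  then show ?thesis
    using assms by (simp add: mult_entry[of _ n] del: index_mult_mat(1))
qed

lemma E_mult_E:
  assumes "i < n" "j < n" "k < n"
  shows "E n i j * E n j k = (E n i k :: 'a::semiring_1 mat)"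
  by (rule square_mat_eqI[of _ n])
    (use assms in \<open>auto simp: E_mult_entry E_entry mult_carrier_mat[of _ n n] simp del: index_mult_mat(1)\<close>)

lemma E_mult_E_zero:
  assumes "i < n" "j < n" "k < n" "l < n" "j \<noteq> k"
  shows "E n i j * E n k l = (0\<^sub>m n n :: 'a::semiring_1 mat)"
  by (rule square_mat_eqI[of _ n])
    (use assms in \<open>auto simp: E_mult_entry E_entry mult_carrier_mat[of _ n n] simp del: index_mult_mat(1)\<close>)

lemma E_sandwich:
  fixes A :: "'a::comm_semiring_1 mat"
  assumes A: "A \<in> carrier_mat n n" and ij: "i < n" "j < n" "k < n" "l < n"
  shows "E n i j * A * E n k l = A $$ (j, k) \<cdot>\<^sub>m E n i l"
proof (rule square_mat_eqI[of _ n])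
  have EA: "E n i j * A \<in> carrier_mat n n"
    using A by (intro mult_carrier_mat[of _ n n]) auto
  then show "E n i j * A * E n k l \<in> carrier_mat n n"
    by (rule mult_carrier_mat) simp
  fix r c
  assume "r < n" "c < n"
  then show "(E n i j * A * E n k l) $$ (r, c) = (A $$ (j, k) \<cdot>\<^sub>m E n i l) $$ (r, c)"
    using A EA ij
    by (simp add: mult_E_entry E_mult_entry E_entry del: index_mult_mat(1))
qed auto

section \<open>The flip along the secondary diagonal\<close>

lemma flip_carrier [simp]: "canonical_involution n A \<in> carrier_mat n n"
  by (simp add: canonical_involution_def)

lemma flip_dim [simp]:
  "dim_row (canonical_involution n A) = n" "dim_col (canonical_involution n A) = n"
  by (simp_all add: canonical_involution_def)

lemma flip_entry:
  "r < n \<Longrightarrow> c < n \<Longrightarrow> canonical_involution n A $$ (r, c) = A $$ (n - 1 - c, n - 1 - r)"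
  by (simp add: canonical_involution_def)

lemma flip_mult:
  fixes A B :: "'a::comm_semiring_0 mat"
  assumes "A \<in> carrier_mat n n" "B \<in> carrier_mat n n"
  shows "canonical_involution n (A * B) = canonical_involution n B * canonical_involution n A"
proof (intro eq_matI)
  fix r c
  assume "r < dim_row (canonical_involution n B * canonical_involution n A)"
    "c < dim_col (canonical_involution n B * canonical_involution n A)"
  then have rc: "r < n" "c < n"
    by (auto simp: canonical_involution_def)
  have "(\<Sum>p<n. A $$ (n - 1 - c, p) * B $$ (p, n - 1 - r))
      = (\<Sum>p<n. A $$ (n - 1 - c, n - 1 - p) * B $$ (n - 1 - p, n - 1 - r))"
    by (rule sum.reindex_bij_witness[of _ "\<lambda>p. n - 1 - p" "\<lambda>p. n - 1 - p"]) auto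
  also have "\<dots> = (\<Sum>p<n. canonical_involution n B $$ (r, p) * canonical_involution n A $$ (p, c))"
    using rc by (intro sum.cong) (auto simp: flip_entry mult.commute)
  finally show "canonical_involution n (A * B) $$ (r, c)
      = (canonical_involution n B * canonical_involution n A) $$ (r, c)"
    using rc assms
    by (simp add: flip_entry mult_entry[OF assms] mult_entry[OF flip_carrier flip_carrier]
        del: index_mult_mat(1))
qed (auto simp: canonical_involution_def)

lemma flip_one: "canonical_involution n (1\<^sub>m n) = 1\<^sub>m n"
  by (intro eq_matI) (auto simp: canonical_involution_def)

lemma flip_smult:
  assumes "A \<in> carrier_mat n n"
  shows "canonical_involution n (a \<cdot>\<^sub>m A) = a \<cdot>\<^sub>m canonical_involution n A"
  using assms by (intro eq_matI) (auto simp: canonical_involution_def)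

section \<open>Degrees of matrix units\<close>

lemma (in group) foldr_mult_one:
  assumes "\<And>x. x \<in> set xs \<Longrightarrow> f x \<in> carrier G" "y \<in> carrier G"
  shows "foldr (\<lambda>k x. f k \<otimes> x) xs y = foldr (\<lambda>k x. f k \<otimes> x) xs \<one> \<otimes> y
    \<and> foldr (\<lambda>k x. f k \<otimes> x) xs \<one> \<in> carrier G"
  using assms by (induction xs) (auto simp: m_assoc)

context group
begin

context
  fixes n :: nat and \<eta> :: "nat \<Rightarrow> 'a"
  assumes \<eta>: "\<eta> \<in> {1..n - 1} \<rightarrow> carrier G"
begin

lemma unit_degree_closed:
  assumes "1 \<le> i" "j \<le> n"
  shows "unit_degree G \<eta> i j \<in> carrier G"
  unfolding unit_degree_def
  by (rule conjunct2[OF foldr_mult_one[where y = \<one>]]) (use assms \<eta> in auto)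

lemma unit_degree_mult:
  assumes "1 \<le> i" "i \<le> j" "j \<le> k" "k \<le> n"
  shows "unit_degree G \<eta> i j \<otimes> unit_degree G \<eta> j k = unit_degree G \<eta> i k"
proof -
  have "[i..<k] = [i..<j] @ [j..<k]"
    using assms upt_add_eq_append[of i j "k - j"] by simp
  then have "unit_degree G \<eta> i k = foldr (\<lambda>k x. \<eta> k \<otimes> x) [i..<j] (unit_degree G \<eta> j k)"
    by (simp add: unit_degree_def)
  also have "\<dots> = unit_degree G \<eta> i j \<otimes> unit_degree G \<eta> j k"
    unfolding unit_degree_def[of G \<eta> i j]
    by (rule conjunct1[OF foldr_mult_one]) (use assms \<eta> unit_degree_closed[of j k] in auto)
  finally show ?thesis by simp
qed

text \<open>Inverting a product reverses its order, and so does reading \<open>\<eta>\<close> from the other end.\<close>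

lemma unit_degree_flip:
  assumes pal: "\<forall>i\<in>{1..n - 1}. \<eta> i = inv\<^bsub>G\<^esub> (\<eta> (n - i))" and "1 \<le> i" "i \<le> j" "j \<le> n"
  shows "inv\<^bsub>G\<^esub> (unit_degree G \<eta> i j) = unit_degree G \<eta> (n + 1 - j) (n + 1 - i)"
  using \<open>i \<le> j\<close> \<open>j \<le> n\<close>
proof (induction j rule: dec_induct)
  case base
  then show ?case by (simp add: unit_degree_refl)
next
  case (step j)
  have \<eta>j: "\<eta> j \<in> carrier G" "\<eta> (n - j) \<in> carrier G"
    using step \<open>1 \<le> i\<close> by (auto intro!: funcset_mem[OF \<eta>])
  have "\<eta> j = inv (\<eta> (n - j))"
    using pal step \<open>1 \<le> i\<close> by auto
  then have "inv (\<eta> j) = \<eta> (n - j)"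
    using \<eta>j by simp
  moreover have "unit_degree G \<eta> i (Suc j) = unit_degree G \<eta> i j \<otimes> \<eta> j"
    using step \<open>1 \<le> i\<close> unit_degree_mult[of i j "Suc j"] \<eta>j by (simp add: unit_degree_Suc)
  moreover have "unit_degree G \<eta> (n - j) (n + 1 - i)
      = \<eta> (n - j) \<otimes> unit_degree G \<eta> (n + 1 - j) (n + 1 - i)"
    using step \<open>1 \<le> i\<close> unit_degree_mult[of "n - j" "Suc (n - j)" "n + 1 - i"] \<eta>j
    by (simp add: unit_degree_Suc Suc_diff_le One_nat_def)
  ultimately show ?case
    using step \<open>1 \<le> i\<close> \<eta>j unit_degree_closed[of i j] by (simp add: inv_mult_group)
qed

end

end

lemma homogeneous_componentD:
  assumes "A \<in> homogeneous_component G n \<eta> g"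
  shows "A \<in> UT n" "r < n \<Longrightarrow> c < n \<Longrightarrow> A $$ (r, c) \<noteq> 0 \<Longrightarrow> unit_degree G \<eta> (Suc r) (Suc c) = g"
  using assms by (auto simp: homogeneous_component_def)

lemma homogeneous_componentI:
  assumes "A \<in> UT n"
    "\<And>r c. r \<le> c \<Longrightarrow> c < n \<Longrightarrow> A $$ (r, c) \<noteq> 0 \<Longrightarrow> unit_degree G \<eta> (Suc r) (Suc c) = g"
  shows "A \<in> homogeneous_component G n \<eta> g"
  using assms UT_lower_entry[OF assms(1)] unfolding homogeneous_component_def
  by (simp, meson not_le)


section \<open>The corner matrix unit\<close>

lemma E_corner_mult:
  fixes Y :: "'a::comm_semiring_1 mat"
  assumes "Y \<in> UT n" "0 < n"
  shows "E n 0 (n - 1) * Y = Y $$ (n - 1, n - 1) \<cdot>\<^sub>m E n 0 (n - 1)"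
    and "Y * E n 0 (n - 1) = Y $$ (0, 0) \<cdot>\<^sub>m E n 0 (n - 1)"
proof -
  have Y: "Y \<in> carrier_mat n n"
    using assms UT_carrier by blast
  have zero: "Y $$ (n - 1, j) = 0" if "j < n" "j \<noteq> n - 1" for j
    using that assms by (intro UT_lower_entry) auto
  have zero': "Y $$ (i, 0) = 0" if "i < n" "i \<noteq> 0" for i
    using that assms by (intro UT_lower_entry) auto
  show "E n 0 (n - 1) * Y = Y $$ (n - 1, n - 1) \<cdot>\<^sub>m E n 0 (n - 1)"
    by (rule square_mat_eqI[of _ n])
      (use Y assms zero in
        \<open>auto simp: E_mult_entry E_entry mult_carrier_mat[of _ n n] simp del: index_mult_mat(1)\<close>)
  show "Y * E n 0 (n - 1) = Y $$ (0, 0) \<cdot>\<^sub>m E n 0 (n - 1)"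
    by (rule square_mat_eqI[of _ n])
      (use Y assms zero' in
        \<open>auto simp: mult_E_entry E_entry mult_carrier_mat[of _ n n] simp del: index_mult_mat(1)\<close>)
qed

text \<open>Multiplying by a matrix unit moves a row of \<open>X\<close> to the top, or a column to the far right. If \<open>X\<close>
  had a nonzero entry outside the corner, the moved matrix would vanish at the old place without
  vanishing altogether, so it would not be a multiple of \<open>X\<close>.\<close>

lemma one_dim_ideal_corner:
  fixes X :: "'a::field mat"
  assumes X: "X \<in> UT n" and n: "0 < n"
    and right: "\<And>Y. Y \<in> UT n \<Longrightarrow> \<exists>a. X * Y = a \<cdot>\<^sub>m X"
    and left: "\<And>Y. Y \<in> UT n \<Longrightarrow> \<exists>a. Y * X = a \<cdot>\<^sub>m X"
  shows "X = X $$ (0, n - 1) \<cdot>\<^sub>m E n 0 (n - 1)"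
proof -
  note Xc = UT_carrier[OF X]
  have row: "r = 0" if rs: "r < n" "s < n" "X $$ (r, s) \<noteq> 0" for r s
  proof (rule ccontr)
    assume "r \<noteq> 0"
    obtain a where a: "E n 0 r * X = a \<cdot>\<^sub>m X"
      using left E_UT[of 0 r n] by auto
    have "a * X $$ (r, s) = 0"
      using arg_cong[OF a, of "\<lambda>M. M $$ (r, s)"] Xc rs \<open>r \<noteq> 0\<close> by (simp add: E_mult_entry del: index_mult_mat(1))
    moreover have "X $$ (r, s) = a * X $$ (0, s)"
      using arg_cong[OF a, of "\<lambda>M. M $$ (0, s)"] Xc rs by (simp add: E_mult_entry del: index_mult_mat(1))
    ultimately show False
      using rs by auto
  qed
  have col: "s = n - 1" if rs: "r < n" "s < n" "X $$ (r, s) \<noteq> 0" for r s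
  proof (rule ccontr)
    assume "s \<noteq> n - 1"
    obtain a where a: "X * E n s (n - 1) = a \<cdot>\<^sub>m X"
      using right[OF E_UT[of s "n - 1" n]] rs by force
    have "a * X $$ (r, s) = 0"
      using arg_cong[OF a, of "\<lambda>M. M $$ (r, s)"] Xc rs \<open>s \<noteq> n - 1\<close>
      by (simp add: mult_E_entry del: index_mult_mat(1))
    moreover have "X $$ (r, s) = a * X $$ (r, n - 1)"
      using arg_cong[OF a, of "\<lambda>M. M $$ (r, n - 1)"] Xc rs
      by (simp add: mult_E_entry del: index_mult_mat(1))
    ultimately show False
      using rs by auto
  qed
  show ?thesis
  proof (rule square_mat_eqI[of _ n])
    fix i j
    assume "i < n" "j < n"
    then show "X $$ (i, j) = (X $$ (0, n - 1) \<cdot>\<^sub>m E n 0 (n - 1)) $$ (i, j)"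
      using row[of i j] col[of i j] by (cases "X $$ (i, j) = 0") (auto simp: E_entry)
  qed (use Xc in auto)
qed

lemma UT_linear_bijD:
  assumes "UT_linear_bij n f"
  shows "A \<in> UT n \<Longrightarrow> f A \<in> UT n"
    and "A \<in> UT n \<Longrightarrow> f (a \<cdot>\<^sub>m A) = a \<cdot>\<^sub>m f A"
    and "0 < n \<Longrightarrow> f (E n 0 (n - 1)) \<noteq> 0\<^sub>m n n"
    and "B \<in> UT n \<Longrightarrow> \<exists>A\<in>UT n. f A = B"
proof -
  have bij: "bij_betw f (UT n) (UT n)"
    using assms by (simp add: UT_linear_bij_def)
  show "A \<in> UT n \<Longrightarrow> f A \<in> UT n"
    using bij by (rule bij_betw_apply)
  show smult: "A \<in> UT n \<Longrightarrow> f (a \<cdot>\<^sub>m A) = a \<cdot>\<^sub>m f A" for a A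
    using assms by (simp add: UT_linear_bij_def)
  show "B \<in> UT n \<Longrightarrow> \<exists>A\<in>UT n. f A = B"
    using bij_betw_imp_surj_on[OF bij] by (metis imageE)
  assume n: "0 < n"
  let ?E = "E n 0 (n - 1) :: 'a mat"
  have UT: "?E \<in> UT n" "0\<^sub>m n n \<in> UT n"
    using E_UT[of 0 "n - 1" n] by (auto simp: UT_iff)
  have "f (0\<^sub>m n n) = 0\<^sub>m n n"
    using smult[OF UT(1), of 0] bij_betw_apply[OF bij UT(1), THEN UT_carrier]
    by (simp add: zero_smult_mat[of _ n])
  moreover have "?E \<noteq> 0\<^sub>m n n"
  proof
    assume "?E = 0\<^sub>m n n"
    from arg_cong[OF this, of "\<lambda>M. M $$ (0, n - 1)"] n show False
      by (simp add: E_entry)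
  qed
  ultimately show "f ?E \<noteq> 0\<^sub>m n n"
    using bij UT unfolding bij_betw_def by (metis inj_onD)
qed

text \<open>Automorphisms and anti-automorphisms permute the one-dimensional two-sided ideals, of which there
  is only one. Both kinds are needed: the first for the invariance of the sign, the second to define
  it.\<close>

lemma image_corner:
  fixes f :: "'a::field mat \<Rightarrow> 'a mat"
  assumes f: "UT_linear_bij n f" and n: "0 < n"
    and mult: "(\<forall>A\<in>UT n. \<forall>B\<in>UT n. f (A * B) = f A * f B) \<or>
      (\<forall>A\<in>UT n. \<forall>B\<in>UT n. f (A * B) = f B * f A)"
  obtains d where "d \<noteq> 0" "f (E n 0 (n - 1)) = d \<cdot>\<^sub>m E n 0 (n - 1)"
proof -
  let ?E = "E n 0 (n - 1) :: 'a mat"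
  have UT: "?E \<in> UT n"
    by (simp add: E_UT)
  have ideal: "(\<exists>a. f ?E * Y = a \<cdot>\<^sub>m f ?E) \<and> (\<exists>a. Y * f ?E = a \<cdot>\<^sub>m f ?E)" if Y: "Y \<in> UT n" for Y
  proof -
    obtain Z where Z: "Z \<in> UT n" "f Z = Y"
      using UT_linear_bijD(4)[OF f Y] by blast
    have "\<exists>a. f (Z * ?E) = a \<cdot>\<^sub>m f ?E" "\<exists>a. f (?E * Z) = a \<cdot>\<^sub>m f ?E"
      using E_corner_mult[OF Z(1) n] UT_linear_bijD(2)[OF f UT] by auto
    moreover have "f (Z * ?E) = Y * f ?E \<and> f (?E * Z) = f ?E * Y \<or>
        f (Z * ?E) = f ?E * Y \<and> f (?E * Z) = Y * f ?E"
      using mult UT Z by blast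
    ultimately show ?thesis
      by auto
  qed
  have eq: "f ?E = f ?E $$ (0, n - 1) \<cdot>\<^sub>m ?E"
    using ideal UT_linear_bijD(1)[OF f UT] n by (intro one_dim_ideal_corner) auto
  have nonzero: "f ?E $$ (0, n - 1) \<noteq> 0"
  proof
    assume "f ?E $$ (0, n - 1) = 0"
    with eq have "f ?E = 0 \<cdot>\<^sub>m ?E"
      by simp
    also have "\<dots> = 0\<^sub>m n n"
      by (simp add: zero_smult_mat)
    finally show False
      using UT_linear_bijD(3)[OF f n] by simp
  qed
  show ?thesis
    using nonzero eq by (rule that)
qed

section \<open>The bilinear form of an involution\<close>

locale UT_antiinvolution =
  fixes n :: nat and \<rho> :: "'a::field mat \<Rightarrow> 'a mat"
  assumes n: "0 < n" and involution: "UT_involution n \<rho>"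
begin

lemma linear_bij: "UT_linear_bij n \<rho>"
  using involution by (simp add: UT_involution_def UT_antiautomorphism_def)

lemmas closed = UT_linear_bijD(1)[OF linear_bij]
lemmas smult = UT_linear_bijD(2)[OF linear_bij]

lemma mult: "A \<in> UT n \<Longrightarrow> B \<in> UT n \<Longrightarrow> \<rho> (A * B) = \<rho> B * \<rho> A"
  using involution by (simp add: UT_involution_def UT_antiautomorphism_def)

lemma invol: "A \<in> UT n \<Longrightarrow> \<rho> (\<rho> A) = A"
  using involution by (simp add: UT_involution_def)

lemma zero: "\<rho> (0\<^sub>m n n) = 0\<^sub>m n n"
proof -
  show ?thesis
    using smult[OF UT_one, of 0] UT_carrier[OF closed[OF UT_one]]
    by (simp add: zero_smult_mat[of _ n])
qed

lemma one: "\<rho> (1\<^sub>m n) = 1\<^sub>m n"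
proof -
  have "\<rho> (1\<^sub>m n) = \<rho> (1\<^sub>m n) * \<rho> (\<rho> (1\<^sub>m n))"
    using invol[OF UT_one] UT_carrier[OF closed[OF UT_one]] by simp
  also have "\<dots> = \<rho> (\<rho> (1\<^sub>m n) * 1\<^sub>m n)"
    by (simp add: mult closed UT_one)
  also have "\<dots> = 1\<^sub>m n"
    using invol[OF UT_one] UT_carrier[OF closed[OF UT_one]] by simp
  finally show ?thesis .
qed

text \<open>The scalar \<open>\<epsilon>\<close> by which \<open>\<rho>\<close> acts on the corner unit; it turns out to be the symmetry sign of
  the form.\<close>

definition form_sign :: 'a where
  "form_sign = \<rho> (E n 0 (n - 1)) $$ (0, n - 1)"

lemma corner: "\<rho> (E n 0 (n - 1)) = form_sign \<cdot>\<^sub>m E n 0 (n - 1)"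
proof -
  obtain d where d: "\<rho> (E n 0 (n - 1)) = d \<cdot>\<^sub>m E n 0 (n - 1)"
    using image_corner[OF linear_bij n] mult by metis
  have "form_sign = d"
    using n by (simp add: form_sign_def d E_entry)
  with d show ?thesis
    by simp
qed

lemma form_sign_sq: "form_sign * form_sign = 1"
proof -
  have UT: "E n 0 (n - 1) \<in> UT n"
    by (simp add: E_UT)
  have "E n 0 (n - 1) = form_sign \<cdot>\<^sub>m (form_sign \<cdot>\<^sub>m E n 0 (n - 1))"
    using invol[OF UT] by (simp add: corner smult[OF UT])
  from arg_cong[OF this, of "\<lambda>M. M $$ (0, n - 1)"] show ?thesis
    using n by (simp add: E_entry)
qed

text \<open>The matrix unit has square zero, hence so has its image, whose squared diagonal entries
  therefore vanish.\<close>

lemma image_strict: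
  assumes "i < j" "j < n" "r < n"
  shows "\<rho> (E n i j) $$ (r, r) = 0"
proof -
  have UT: "E n i j \<in> UT n"
    using assms by (simp add: E_UT)
  have "\<rho> (E n i j) * \<rho> (E n i j) = 0\<^sub>m n n"
    using assms zero E_mult_E_zero[of i n j i j, where 'a='a] by (simp flip: mult[OF UT UT])
  then show ?thesis
    using UT_mult_diag[OF closed[OF UT] closed[OF UT] \<open>r < n\<close>] assms by simp
qed

text \<open>The matrix unit is a product of \<open>m\<close> superdiagonal units and one diagonal unit. Each of the \<open>m\<close>
  strictly upper triangular factors in the image pushes the support one step to the right.\<close>

lemma image_last_column_support:
  assumes "m < n" "l < n" "\<rho> (E n (n - 1 - m) (n - 1)) $$ (0, l) \<noteq> 0"
  shows "m \<le> l"
  using assms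
proof (induction m arbitrary: l)
  case (Suc m)
  let ?A = "E n (n - 1 - Suc m) (n - 1 - m) :: 'a mat" and ?B = "E n (n - 1 - m) (n - 1) :: 'a mat"
  have UT: "?A \<in> UT n" "?B \<in> UT n"
    by (auto intro: E_UT)
  have "E n (n - 1 - Suc m) (n - 1) = ?A * ?B"
    using Suc.prems by (intro E_mult_E[symmetric]) auto
  then have "(\<rho> ?B * \<rho> ?A) $$ (0, l) \<noteq> 0"
    using Suc.prems UT by (simp add: mult del: index_mult_mat(1))
  then obtain p where p: "p \<le> l" "\<rho> ?B $$ (0, p) \<noteq> 0" "\<rho> ?A $$ (p, l) \<noteq> 0"
    using UT_mult_nonzero_between[OF closed[OF UT(2)] closed[OF UT(1)] n \<open>l < n\<close>] by blast
  have "p \<noteq> l"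
    using p(3) Suc.prems image_strict[of "n - 1 - Suc m" "n - 1 - m" l] by auto
  moreover have "m \<le> p"
    using p Suc.prems by (intro Suc.IH) auto
  ultimately show ?case
    using p(1) by simp
qed simp

lemma image_first_row_support:
  assumes "m < n" "l < n" "\<rho> (E n 0 m) $$ (l, n - 1) \<noteq> 0"
  shows "l + m \<le> n - 1"
  using assms
proof (induction m arbitrary: l)
  case (Suc m)
  let ?A = "E n 0 m :: 'a mat" and ?B = "E n m (Suc m) :: 'a mat"
  have UT: "?A \<in> UT n" "?B \<in> UT n"
    by (auto intro: E_UT)
  have "E n 0 (Suc m) = ?A * ?B"
    using Suc.prems by (intro E_mult_E[symmetric]) auto
  then have "(\<rho> ?B * \<rho> ?A) $$ (l, n - 1) \<noteq> 0"
    using Suc.prems UT by (simp add: mult del: index_mult_mat(1))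
  moreover have "n - 1 < n"
    using n by simp
  ultimately obtain p where p: "l \<le> p" "p \<le> n - 1" "\<rho> ?B $$ (l, p) \<noteq> 0" "\<rho> ?A $$ (p, n - 1) \<noteq> 0"
    using UT_mult_nonzero_between[OF closed[OF UT(2)] closed[OF UT(1)] \<open>l < n\<close>]
    by blast
  have "p \<noteq> l"
    using p(3) Suc.prems image_strict[of m "Suc m" l] by auto
  moreover have "p + m \<le> n - 1"
    using p n Suc.prems by (intro Suc.IH) auto
  ultimately show ?case
    using p(1) by simp
qed simp

text \<open>The Gram matrix of the form for the last column of matrix units. The form vanishes on two
  steps of the standard flag whose dimensions add up to at most \<open>n\<close>; with the rows reversed, this
  says that the matrix is upper triangular.\<close>

definition gram :: "'a mat" where
  "gram = mat n n (\<lambda>(k, l). \<rho> (E n (n - 1 - k) (n - 1)) $$ (0, l))"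

text \<open>The counterpart of \<open>gram\<close> for the first row of matrix units; up to the factor \<open>form_sign\<close> it is
  the inverse.\<close>

definition cogram :: "'a mat" where
  "cogram = mat n n (\<lambda>(l, k). \<rho> (E n 0 (n - 1 - k)) $$ (l, n - 1))"

lemma gram_UT: "gram \<in> UT n"
proof -
  have "\<rho> (E n (n - 1 - k) (n - 1)) $$ (0, l) = 0" if "k < n" "l < k" for k l
    using image_last_column_support[of k l] that by force
  then show ?thesis
    by (auto simp: UT_iff gram_def)
qed

lemma cogram_UT: "cogram \<in> UT n"
proof -
  have "\<rho> (E n 0 (n - 1 - k)) $$ (l, n - 1) = 0" if "l < n" "k < l" for k l
  proof (rule ccontr)
    assume "\<rho> (E n 0 (n - 1 - k)) $$ (l, n - 1) \<noteq> 0"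
    from image_first_row_support[OF _ \<open>l < n\<close> this] n that show False
      by simp
  qed
  then show ?thesis
    by (auto simp: UT_iff cogram_def)
qed

text \<open>Every entry on the left is the corner entry of the image of a product
  \<open>E n 0 j * A * E n i (n - 1)\<close>, and that product is an entry of \<open>A\<close> times the corner unit.\<close>

lemma gram_image_cogram:
  assumes A: "A \<in> UT n"
  shows "gram * \<rho> A * cogram = form_sign \<cdot>\<^sub>m canonical_involution n A"
proof (rule square_mat_eqI[of _ n])
  note car = UT_carrier[OF gram_UT] UT_carrier[OF cogram_UT] UT_carrier[OF closed[OF A]]
  show "gram * \<rho> A * cogram \<in> carrier_mat n n"
    using car by auto
  fix k l
  assume kl: "k < n" "l < n"
  let ?L = "E n 0 (n - 1 - l) :: 'a mat" and ?K = "E n (n - 1 - k) (n - 1) :: 'a mat"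
  have UT: "?L \<in> UT n" "?K \<in> UT n" "E n 0 (n - 1) \<in> UT n"
    by (auto intro: E_UT)
  note UT' = closed[OF UT(1)] closed[OF UT(2)] closed[OF A]
  note car' = UT'[THEN UT_carrier]
  have "row (gram * \<rho> A) k = row (\<rho> ?K * \<rho> A) 0"
    using kl car car' n by (intro eq_vecI) (auto simp: gram_def scalar_prod_def)
  moreover have "col cogram l = col (\<rho> ?L) (n - 1)"
    using kl car' n by (intro eq_vecI) (auto simp: cogram_def)
  ultimately have "(gram * \<rho> A * cogram) $$ (k, l) = (\<rho> ?K * \<rho> A * \<rho> ?L) $$ (0, n - 1)"
    using kl n car car' index_mult_mat(1)[of k "gram * \<rho> A" l cogram]
      index_mult_mat(1)[of 0 "\<rho> ?K * \<rho> A" "n - 1" "\<rho> ?L"] by (simp del: index_mult_mat(1))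
  also have "\<rho> ?K * \<rho> A * \<rho> ?L = \<rho> (?L * A * ?K)"
    using UT A UT_mult[OF UT(1) A] assoc_mult_mat[OF car'(2,3,1)] by (simp add: mult)
  also have "?L * A * ?K = A $$ (n - 1 - l, n - 1 - k) \<cdot>\<^sub>m E n 0 (n - 1)"
    using kl n UT_carrier[OF A] by (intro E_sandwich) auto
  finally show "(gram * \<rho> A * cogram) $$ (k, l) = (form_sign \<cdot>\<^sub>m canonical_involution n A) $$ (k, l)"
    using kl n
    by (simp add: mult.commute smult[OF UT(3)] corner flip_entry E_entry)
qed auto

lemma gram_cogram: "gram * cogram = form_sign \<cdot>\<^sub>m 1\<^sub>m n"
  using gram_image_cogram[OF UT_one] UT_carrier[OF gram_UT] by (simp add: one flip_one)

definition gram_inv :: "'a mat" where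
  "gram_inv = form_sign \<cdot>\<^sub>m cogram"

lemma gram_inv_UT: "gram_inv \<in> UT n"
  using cogram_UT by (auto simp: gram_inv_def UT_iff)

lemma gram_gram_inv: "gram * gram_inv = 1\<^sub>m n"
proof -
  have "gram * gram_inv = form_sign \<cdot>\<^sub>m (form_sign \<cdot>\<^sub>m 1\<^sub>m n)"
    unfolding gram_inv_def using UT_carrier[OF gram_UT] UT_carrier[OF cogram_UT]
    by (simp add: mult_smult_distrib gram_cogram)
  also have "\<dots> = 1\<^sub>m n"
    by (rule square_mat_eqI[of _ n]) (auto simp: form_sign_sq)
  finally show ?thesis .
qed

lemma gram_inv_gram: "gram_inv * gram = 1\<^sub>m n"
  by (rule mat_mult_left_right_inverse[OF _ _ gram_gram_inv])
    (rule UT_carrier, rule gram_UT, rule UT_carrier, rule gram_inv_UT)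

text \<open>The adjointness of \<open>\<rho>\<close> with respect to the form.\<close>

lemma gram_image:
  assumes A: "A \<in> UT n"
  shows "gram * \<rho> A = canonical_involution n A * gram"
proof -
  note car = UT_carrier[OF gram_UT] UT_carrier[OF cogram_UT] UT_carrier[OF gram_inv_UT]
    UT_carrier[OF closed[OF A]]
  have "gram * \<rho> A * gram_inv = form_sign \<cdot>\<^sub>m (form_sign \<cdot>\<^sub>m canonical_involution n A)"
    unfolding gram_inv_def using car by (simp add: mult_smult_distrib[of _ n n] gram_image_cogram[OF A])
  also have "\<dots> = canonical_involution n A"
    by (rule square_mat_eqI[of _ n])
      (use form_sign_sq in \<open>auto simp flip: mult.assoc\<close>)
  finally have "gram * \<rho> A * gram_inv * gram = canonical_involution n A * gram"
    by simp
  moreover have "gram * \<rho> A * gram_inv * gram = gram * \<rho> A * (gram_inv * gram)"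
    using car by (intro assoc_mult_mat[of _ n n _ n _ n]) auto
  ultimately show ?thesis
    using car by (simp add: gram_inv_gram)
qed

lemma gram_diag_nonzero:
  assumes "k < n"
  shows "gram $$ (k, k) \<noteq> 0"
  using UT_mult_diag[OF gram_UT gram_inv_UT assms] assms by (auto simp: gram_gram_inv)

text \<open>The form is symmetric or skew. With \<open>P\<close> the first diagonal unit, \<open>P * \<rho> x * y\<close> is \<open>B(x, y)\<close> times
  the corner unit, and \<open>\<rho>\<close> turns it into \<open>\<rho> y * x * \<rho> P\<close>, whose corner entry is \<open>B(y, x)\<close>.\<close>

lemma flip_gram: "canonical_involution n gram = form_sign \<cdot>\<^sub>m gram"
proof (rule square_mat_eqI[of _ n])
  fix k l
  assume kl: "k < n" "l < n"
  let ?a = "n - 1 - k"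
  let ?A = "E n ?a (n - 1) :: 'a mat" and ?B = "E n l (n - 1) :: 'a mat" and ?P = "E n 0 0 :: 'a mat"
    and ?C = "E n 0 (n - 1) :: 'a mat"
  have UT: "?A \<in> UT n" "?B \<in> UT n" "?P \<in> UT n" "?C \<in> UT n"
    using kl by (auto intro: E_UT)
  note UT' = UT[THEN closed]
  note car' = UT'[THEN UT_carrier]
  have "?P * ?C = ?C"
    using n by (intro E_mult_E) auto
  from arg_cong[OF this, of \<rho>] have "form_sign \<cdot>\<^sub>m ?C * \<rho> ?P = form_sign \<cdot>\<^sub>m ?C"
    using UT by (simp add: mult corner)
  from arg_cong[OF this, of "\<lambda>M. M $$ (0, n - 1)"]
  have P: "\<rho> ?P $$ (n - 1, n - 1) = 1"
    using n car' form_sign_sq E_corner_mult(1)[OF UT'(3) n]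
    by (auto simp: mult_smult_assoc_mat[of _ n n] E_entry)
  have "?P * \<rho> ?A * ?B = \<rho> ?A $$ (0, l) \<cdot>\<^sub>m ?C"
    using n kl car' by (intro E_sandwich) auto
  from arg_cong[OF this, of \<rho>] have ident: "\<rho> ?B * (?A * \<rho> ?P) = (\<rho> ?A $$ (0, l) * form_sign) \<cdot>\<^sub>m ?C"
    using UT UT' UT_mult[OF UT(3) UT'(1)] by (simp add: mult invol smult corner smult_smult_mat)
  have assoc: "\<rho> ?B * (?A * \<rho> ?P) = \<rho> ?B * ?A * \<rho> ?P"
    using car' by (intro assoc_mult_mat[symmetric]) auto
  have entry: "(\<rho> ?B * ?A * \<rho> ?P) $$ (0, n - 1) = \<rho> ?B $$ (0, ?a)"
  proof -
    have "(\<rho> ?B * ?A * \<rho> ?P) $$ (0, n - 1)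
        = (\<Sum>p<n. (\<rho> ?B * ?A) $$ (0, p) * \<rho> ?P $$ (p, n - 1))"
      using n car' by (intro mult_entry) (auto intro!: mult_carrier_mat[of _ n n])
    also have "\<dots> = (\<Sum>p<n. if p = n - 1 then \<rho> ?B $$ (0, ?a) else 0)"
      using n kl car' P by (intro sum.cong) (auto simp: mult_E_entry simp del: index_mult_mat(1))
    finally show ?thesis
      using n by simp
  qed
  have "\<rho> ?B $$ (0, ?a) = ((\<rho> ?A $$ (0, l) * form_sign) \<cdot>\<^sub>m ?C) $$ (0, n - 1)"
    unfolding ident[symmetric] assoc entry ..
  also have "\<dots> = \<rho> ?A $$ (0, l) * form_sign"
    using n by (simp add: E_entry)
  finally have "\<rho> ?B $$ (0, ?a) = \<rho> ?A $$ (0, l) * form_sign" .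
  then show "canonical_involution n gram $$ (k, l) = (form_sign \<cdot>\<^sub>m gram) $$ (k, l)"
    using kl by (simp add: flip_entry gram_def)
qed (use UT_carrier[OF gram_UT] in auto)

end


section \<open>The flip and the symplectic involution as one family\<close>

definition half_sign :: "nat \<Rightarrow> 'a::field \<Rightarrow> 'a mat" where
  "half_sign n \<sigma> = mat_diag n (\<lambda>i. if i < n - n div 2 then 1 else \<sigma>)"

definition twisted_flip :: "nat \<Rightarrow> 'a::field \<Rightarrow> 'a mat \<Rightarrow> 'a mat" where
  "twisted_flip n \<sigma> A = half_sign n \<sigma> * canonical_involution n A * half_sign n \<sigma>"

text \<open>The square roots \<open>\<sigma>\<close> of \<open>1\<close> for which the flip multiplies \<open>half_sign n \<sigma>\<close> by \<open>\<sigma>\<close>. For odd \<open>n\<close>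
  the middle entry, which the flip fixes, is \<open>1\<close> and leaves only \<open>\<sigma> = 1\<close>.\<close>

definition admissible_sign :: "nat \<Rightarrow> 'a::field \<Rightarrow> bool" where
  "admissible_sign n \<sigma> \<longleftrightarrow> \<sigma> * \<sigma> = 1 \<and> (odd n \<longrightarrow> \<sigma> = 1)"

lemma half_sign_carrier [simp]: "half_sign n \<sigma> \<in> carrier_mat n n"
  by (simp add: half_sign_def)

lemma twisted_flip_eq:
  "twisted_flip n \<sigma> A = mat n n (\<lambda>(r, c). (if r < n - n div 2 then 1 else \<sigma>)
     * A $$ (n - 1 - c, n - 1 - r) * (if c < n - n div 2 then 1 else \<sigma>))"
  unfolding twisted_flip_def half_sign_def
  by (rule square_mat_eqI[of _ n])
    (auto simp: mat_diag_mult_left[of _ n n] mat_diag_mult_right[of _ n n] flip_entry)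

lemma twisted_flip_one: "twisted_flip n 1 = canonical_involution n"
  by (rule ext) (simp add: twisted_flip_eq canonical_involution_def)

lemma twisted_flip_minus_one: "twisted_flip (2 * m) (- 1) = symplectic_involution m"
  by (rule ext) (simp add: twisted_flip_def half_sign_def symplectic_involution_def Let_def)

lemma half_sign_sq: "\<sigma> * \<sigma> = 1 \<Longrightarrow> half_sign n \<sigma> * half_sign n \<sigma> = 1\<^sub>m n"
  unfolding half_sign_def mat_diag_diag by (rule eq_matI) (auto simp: mat_diag_def)

lemma twisted_flip_UT: "A \<in> UT n \<Longrightarrow> twisted_flip n \<sigma> A \<in> UT n"
  by (auto simp: UT_iff twisted_flip_eq)

lemma twisted_flip_twisted_flip:
  assumes "admissible_sign n \<sigma>" "A \<in> carrier_mat n n"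
  shows "twisted_flip n \<sigma> (twisted_flip n \<sigma> A) = A"
proof (rule square_mat_eqI[of _ n])
  fix i j
  assume ij: "i < n" "j < n"
  let ?s = "\<lambda>i. if i < n - n div 2 then 1 else \<sigma>"
  have s: "?s i * ?s (n - 1 - i) = \<sigma>" if "i < n" for i
  proof (cases "odd n")
    case False
    then show ?thesis
      using that by (auto elim!: evenE)
  qed (use assms in \<open>auto simp: admissible_sign_def\<close>)
  have "twisted_flip n \<sigma> (twisted_flip n \<sigma> A) $$ (i, j)
      = (?s i * ?s (n - 1 - i)) * (?s j * ?s (n - 1 - j)) * A $$ (i, j)"
    unfolding twisted_flip_eq using ij by (simp add: mult_ac)
  also have "\<dots> = A $$ (i, j)"
    unfolding s[OF ij(1)] s[OF ij(2)] using assms by (simp add: admissible_sign_def)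
  finally show "twisted_flip n \<sigma> (twisted_flip n \<sigma> A) $$ (i, j) = A $$ (i, j)" .
qed (use assms in \<open>auto simp: twisted_flip_eq\<close>)

lemma twisted_flip_mult:
  assumes \<sigma>: "admissible_sign n \<sigma>" and A: "A \<in> carrier_mat n n" and B: "B \<in> carrier_mat n n"
  shows "twisted_flip n \<sigma> (A * B) = twisted_flip n \<sigma> B * twisted_flip n \<sigma> A"
proof -
  have S: "half_sign n \<sigma> * half_sign n \<sigma> = 1\<^sub>m n"
    using \<sigma> by (simp add: admissible_sign_def half_sign_sq)
  show ?thesis
    unfolding twisted_flip_def flip_mult[OF A B]
    by (simp add: mult_assoc_square[of _ n] mult_carrier_square mult_cancel_inverse[OF S])
qed

lemma twisted_flip_involution:
  assumes \<sigma>: "admissible_sign n \<sigma>"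
  shows "UT_involution n (twisted_flip n \<sigma>)"
proof -
  have "bij_betw (twisted_flip n \<sigma>) (UT n) (UT n)"
    by (rule bij_betwI[where g = "twisted_flip n \<sigma>"])
      (auto intro: twisted_flip_UT simp: twisted_flip_twisted_flip[OF \<sigma> UT_carrier])
  moreover have "twisted_flip n \<sigma> (A + B) = twisted_flip n \<sigma> A + twisted_flip n \<sigma> B"
    if "A \<in> UT n" "B \<in> UT n" for A B
    by (rule square_mat_eqI[of _ n])
      (use that[THEN UT_carrier] in \<open>auto simp: twisted_flip_eq algebra_simps\<close>)
  moreover have "twisted_flip n \<sigma> (a \<cdot>\<^sub>m A) = a \<cdot>\<^sub>m twisted_flip n \<sigma> A" if "A \<in> UT n" for a A
    by (rule square_mat_eqI[of _ n])
      (use UT_carrier[OF that] in \<open>auto simp: twisted_flip_eq\<close>)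
  ultimately show ?thesis
    by (auto simp: UT_involution_def UT_antiautomorphism_def UT_linear_bij_def
        twisted_flip_mult[OF \<sigma>] twisted_flip_twisted_flip[OF \<sigma>] UT_carrier)
qed

lemma twisted_flip_antiinvolution:
  "0 < n \<Longrightarrow> admissible_sign n \<sigma> \<Longrightarrow> UT_antiinvolution n (twisted_flip n \<sigma>)"
  by (simp add: UT_antiinvolution_def twisted_flip_involution)

lemma twisted_flip_form_sign:
  assumes "0 < n" "admissible_sign n \<sigma>"
  shows "UT_antiinvolution.form_sign n (twisted_flip n \<sigma>) = \<sigma>"
proof -
  have "n - 1 < n - n div 2 \<Longrightarrow> odd n"
    using \<open>0 < n\<close> by (auto elim!: evenE)
  then show ?thesis
    unfolding UT_antiinvolution.form_sign_def[OF twisted_flip_antiinvolution[OF assms]]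
    using assms by (auto simp: twisted_flip_eq E_entry admissible_sign_def)
qed

lemma (in group) twisted_flip_degree_inverting:
  assumes \<eta>: "\<eta> \<in> {1..n - 1} \<rightarrow> carrier G"
    and pal: "\<forall>i\<in>{1..n - 1}. \<eta> i = inv (\<eta> (n - i))"
    and \<sigma>: "admissible_sign n \<sigma>"
  shows "degree_inverting_involution G n \<eta> (twisted_flip n \<sigma>)"
proof -
  have "twisted_flip n \<sigma> A \<in> homogeneous_component G n \<eta> (inv g)"
    if A: "A \<in> homogeneous_component G n \<eta> g" for A g
  proof (rule homogeneous_componentI)
    show "twisted_flip n \<sigma> A \<in> UT n"
      using homogeneous_componentD(1)[OF A] by (rule twisted_flip_UT)
    fix r c
    assume rc: "r \<le> c" "c < n" "twisted_flip n \<sigma> A $$ (r, c) \<noteq> 0"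
    then have "A $$ (n - 1 - c, n - 1 - r) \<noteq> 0"
      by (auto simp: twisted_flip_eq)
    moreover have "Suc (n - 1 - c) = n - c" "Suc (n - 1 - r) = n - r"
      using rc by auto
    ultimately have "unit_degree G \<eta> (n - c) (n - r) = g"
      using homogeneous_componentD(2)[OF A, of "n - 1 - c" "n - 1 - r"] rc by auto
    then show "unit_degree G \<eta> (Suc r) (Suc c) = inv g"
      using unit_degree_flip[OF \<eta> pal, of "n - c" "n - r"] rc by (simp add: Suc_diff_le One_nat_def)
  qed
  then show ?thesis
    using twisted_flip_involution[OF \<sigma>] by (auto simp: degree_inverting_involution_def)
qed

text \<open>An automorphism maps the corner unit to a nonzero multiple of itself, and this factor cancels on
  the two sides of the intertwining relation.\<close>

lemma equivalent_form_sign: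
  assumes \<rho>: "UT_antiinvolution n \<rho>" and \<rho>': "UT_antiinvolution n \<rho>'"
    and equiv: "equivalent_involutions G n \<eta> \<rho> \<rho>'"
  shows "UT_antiinvolution.form_sign n \<rho> = UT_antiinvolution.form_sign n \<rho>'"
proof -
  interpret \<rho>: UT_antiinvolution n \<rho> by (rule \<rho>)
  interpret \<rho>': UT_antiinvolution n \<rho>' by (rule \<rho>')
  obtain \<phi> where \<phi>: "UT_automorphism n \<phi>" "\<And>A. A \<in> UT n \<Longrightarrow> \<phi> (\<rho> A) = \<rho>' (\<phi> A)"
    using equiv by (auto simp: equivalent_involutions_def graded_automorphism_def)
  have lin: "UT_linear_bij n \<phi>"
    using \<phi>(1) by (simp add: UT_automorphism_def)
  have UT: "E n 0 (n - 1) \<in> UT n"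
    by (simp add: E_UT)
  obtain d where d: "d \<noteq> 0" "\<phi> (E n 0 (n - 1)) = d \<cdot>\<^sub>m E n 0 (n - 1)"
    using image_corner[OF lin \<rho>.n] \<phi>(1) unfolding UT_automorphism_def by metis
  have "(\<rho>.form_sign * d) \<cdot>\<^sub>m E n 0 (n - 1) = (d * \<rho>'.form_sign) \<cdot>\<^sub>m E n 0 (n - 1)"
    using \<phi>(2)[OF UT]
    unfolding \<rho>.corner UT_linear_bijD(2)[OF lin UT] d(2) \<rho>'.smult[OF UT] \<rho>'.corner smult_smult_mat .
  from arg_cong[OF this, of "\<lambda>M. M $$ (0, n - 1)"] show ?thesis
    using \<rho>.n d(1) by (simp add: E_entry)
qed

section \<open>The Gram matrix is homogeneous\<close>

lemma (in group) homogeneous_component_mult: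
  fixes A B :: "'k::semiring_0 mat"
  assumes \<eta>: "\<eta> \<in> {1..n - 1} \<rightarrow> carrier G"
    and A: "A \<in> homogeneous_component G n \<eta> g" and B: "B \<in> homogeneous_component G n \<eta> h"
  shows "A * B \<in> homogeneous_component G n \<eta> (g \<otimes> h)"
proof (rule homogeneous_componentI)
  note UT = homogeneous_componentD(1)[OF A] homogeneous_componentD(1)[OF B]
  show "A * B \<in> UT n"
    using UT by (rule UT_mult)
  fix r c
  assume rc: "r \<le> c" "c < n" "(A * B) $$ (r, c) \<noteq> 0"
  then obtain p where p: "r \<le> p" "p \<le> c" "A $$ (r, p) \<noteq> 0" "B $$ (p, c) \<noteq> 0"
    using UT_mult_nonzero_between[OF UT, of r c] by auto
  then have "unit_degree G \<eta> (Suc r) (Suc p) = g" "unit_degree G \<eta> (Suc p) (Suc c) = h"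
    using rc homogeneous_componentD(2)[OF A, of r p] homogeneous_componentD(2)[OF B, of p c] by auto
  then show "unit_degree G \<eta> (Suc r) (Suc c) = g \<otimes> h"
    using unit_degree_mult[OF \<eta>, of "Suc r" "Suc p" "Suc c"] p rc by simp
qed

lemma E_homogeneous:
  "i \<le> j \<Longrightarrow> E n i j \<in> homogeneous_component G n \<eta> (unit_degree G \<eta> (Suc i) (Suc j))"
  by (auto simp: homogeneous_component_def E_UT E_entry)

lemma (in group) conjugation_graded_automorphism:
  fixes N N' :: "'k::field mat"
  assumes \<eta>: "\<eta> \<in> {1..n - 1} \<rightarrow> carrier G"
    and N: "N \<in> homogeneous_component G n \<eta> \<one>" and N': "N' \<in> homogeneous_component G n \<eta> \<one>"
    and inverse: "N * N' = 1\<^sub>m n" "N' * N = 1\<^sub>m n"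
  shows "graded_automorphism G n \<eta> (\<lambda>A. N * A * N')"
proof -
  note UT = homogeneous_componentD(1)[OF N] homogeneous_componentD(1)[OF N']
  note car = UT[THEN UT_carrier]
  note simps = mult_assoc_square[of _ n] mult_carrier_square car UT_carrier
    mult_cancel_inverse[OF inverse(1)] mult_cancel_inverse[OF inverse(2)] inverse
  have "bij_betw (\<lambda>A. N * A * N') (UT n) (UT n)"
    by (rule bij_betwI[where g = "\<lambda>A. N' * A * N"])
      (auto intro!: UT_mult UT simp: simps right_mult_one_mat[of _ n])
  moreover have "N * (A + B) * N' = N * A * N' + N * B * N'" if "A \<in> UT n" "B \<in> UT n" for A B
    using car that[THEN UT_carrier]
    by (simp add: mult_add_distrib_mat[of _ n n] add_mult_distrib_mat[of _ n n])
  moreover have "N * (a \<cdot>\<^sub>m A) * N' = a \<cdot>\<^sub>m (N * A * N')" if "A \<in> UT n" for a A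
    using car UT_carrier[OF that]
    by (simp add: mult_smult_distrib[of _ n n] mult_smult_assoc_mat[of _ n n])
  moreover have "N * (A * B) * N' = N * A * N' * (N * B * N')" if "A \<in> UT n" "B \<in> UT n" for A B
    using that by (simp add: simps)
  moreover have "N * A * N' \<in> homogeneous_component G n \<eta> g"
    if "g \<in> carrier G" "A \<in> homogeneous_component G n \<eta> g" for A g
    using homogeneous_component_mult[OF \<eta> homogeneous_component_mult[OF \<eta> N that(2)] N'] that(1)
    by simp
  ultimately show ?thesis
    by (auto simp: graded_automorphism_def UT_automorphism_def UT_linear_bij_def)
qed

locale degree_inverting = group G + UT_antiinvolution n \<rho>
  for G :: "('g, 'm) monoid_scheme" (structure) and n :: nat and \<rho> :: "'a::field mat \<Rightarrow> 'a mat" +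
  fixes \<eta> :: "nat \<Rightarrow> 'g"
  assumes \<eta>: "\<eta> \<in> {1..n - 1} \<rightarrow> carrier G"
    and degree_inverting: "degree_inverting_involution G n \<eta> \<rho>"
begin

lemma image_degree:
  assumes "i \<le> j" "j < n" "r < n" "c < n" "\<rho> (E n i j) $$ (r, c) \<noteq> 0"
  shows "unit_degree G \<eta> (Suc r) (Suc c) = inv (unit_degree G \<eta> (Suc i) (Suc j))"
proof -
  let ?g = "unit_degree G \<eta> (Suc i) (Suc j)"
  have "?g \<in> carrier G"
    using unit_degree_closed[OF \<eta>] \<open>j < n\<close> by simp
  then have "\<rho> ` homogeneous_component G n \<eta> ?g \<subseteq> homogeneous_component G n \<eta> (inv ?g)"
    using degree_inverting by (simp add: degree_inverting_involution_def)
  then have "\<rho> (E n i j) \<in> homogeneous_component G n \<eta> (inv ?g)"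
    using E_homogeneous[OF \<open>i \<le> j\<close>, of n G \<eta>] by (rule subsetD[OF _ imageI])
  then show ?thesis
    using assms(3-5) by (rule homogeneous_componentD(2))
qed

text \<open>For the superdiagonal unit \<open>A = E n (i - 1) i\<close>, the entry of \<open>gram * \<rho> A = \<tau> A * gram\<close> in place
  \<open>(n - 1 - i, n - i)\<close> is a diagonal entry of \<open>gram\<close>, hence nonzero. As \<open>\<rho> A\<close> is strictly upper
  triangular, it must itself have a nonzero entry there, and its degree is \<open>inv (\<eta> i)\<close>.\<close>

lemma palindromic: "\<forall>i\<in>{1..n - 1}. \<eta> i = inv (\<eta> (n - i))"
proof
  fix i
  assume i: "i \<in> {1..n - 1}"
  let ?A = "E n (i - 1) i :: 'a mat"
  have A: "?A \<in> UT n"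
    by (simp add: E_UT)
  have "canonical_involution n ?A = E n (n - 1 - i) (n - i)"
    by (rule square_mat_eqI[of _ n]) (use i in \<open>auto simp: flip_entry E_entry\<close>)
  moreover have "n - 1 - i < n" "n - i < n"
    using i by auto
  ultimately have "(gram * \<rho> ?A) $$ (n - 1 - i, n - i) = gram $$ (n - i, n - i)"
    unfolding gram_image[OF A] using E_mult_entry[OF UT_carrier[OF gram_UT]] by metis
  then have "(gram * \<rho> ?A) $$ (n - 1 - i, n - i) \<noteq> 0"
    using gram_diag_nonzero[of "n - i"] i n by auto
  then obtain p where p: "n - 1 - i \<le> p" "p \<le> n - i" "\<rho> ?A $$ (p, n - i) \<noteq> 0"
    using UT_mult_nonzero_between[OF gram_UT closed[OF A], of "n - 1 - i" "n - i"] i n by auto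
  have "p \<noteq> n - i"
    using p(3) image_strict[of "i - 1" i "n - i"] i by auto
  then have "p = n - 1 - i"
    using p(1,2) by auto
  then have "unit_degree G \<eta> (Suc (n - 1 - i)) (Suc (n - i))
      = inv (unit_degree G \<eta> (Suc (i - 1)) (Suc i))"
    using p(3) i by (intro image_degree) auto
  moreover have "Suc (n - 1 - i) = n - i" "Suc (i - 1) = i"
    using i by auto
  moreover have "\<eta> i \<in> carrier G" "\<eta> (n - i) \<in> carrier G"
    using i by (auto intro!: funcset_mem[OF \<eta>])
  ultimately show "\<eta> i = inv (\<eta> (n - i))"
    by (simp add: unit_degree_Suc)
qed

text \<open>Row \<open>k\<close> is taken from the image of a unit whose degree inverts to that of \<open>E n 0 k\<close>, so
  \<open>E n 0 l\<close> and \<open>E n 0 k\<close> have equal degrees wherever the entry \<open>(k, l)\<close> is nonzero.\<close>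

lemma gram_degree: "gram \<in> homogeneous_component G n \<eta> \<one>"
proof (rule homogeneous_componentI[OF gram_UT])
  fix k l
  assume kl: "k \<le> l" "l < n" "gram $$ (k, l) \<noteq> 0"
  have "unit_degree G \<eta> (Suc 0) (Suc l) = inv (unit_degree G \<eta> (Suc (n - 1 - k)) (Suc (n - 1)))"
    using kl n by (intro image_degree) (auto simp: gram_def)
  also have "\<dots> = unit_degree G \<eta> (Suc 0) (Suc k)"
    using unit_degree_flip[OF \<eta> palindromic, of "n - k" n] kl
    by (simp add: Suc_diff_Suc One_nat_def)
  finally have "unit_degree G \<eta> (Suc 0) (Suc k) \<otimes> unit_degree G \<eta> (Suc k) (Suc l)
      = unit_degree G \<eta> (Suc 0) (Suc k) \<otimes> \<one>"
    using unit_degree_mult[OF \<eta>, of "Suc 0" "Suc k" "Suc l"] unit_degree_closed[OF \<eta>, of "Suc 0" "Suc k"] kl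
    by simp
  then show "unit_degree G \<eta> (Suc k) (Suc l) = \<one>"
    using unit_degree_closed[OF \<eta>, of "Suc 0" "Suc k"] unit_degree_closed[OF \<eta>, of "Suc k" "Suc l"] kl
    by (simp add: One_nat_def)
qed

lemma gram_inv_degree: "gram_inv \<in> homogeneous_component G n \<eta> \<one>"
proof (rule homogeneous_componentI[OF gram_inv_UT])
  fix l k
  assume kl: "l \<le> k" "k < n" "gram_inv $$ (l, k) \<noteq> 0"
  have "unit_degree G \<eta> (Suc l) (Suc (n - 1)) = inv (unit_degree G \<eta> (Suc 0) (Suc (n - 1 - k)))"
    using kl n by (intro image_degree) (auto simp: gram_inv_def cogram_def)
  also have "\<dots> = unit_degree G \<eta> (Suc k) n"
    using unit_degree_flip[OF \<eta> palindromic, of "Suc 0" "n - k"] kl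
    by (simp add: Suc_diff_Suc One_nat_def)
  finally have "unit_degree G \<eta> (Suc l) (Suc k) \<otimes> unit_degree G \<eta> (Suc k) n
      = \<one> \<otimes> unit_degree G \<eta> (Suc k) n"
    using unit_degree_mult[OF \<eta>, of "Suc l" "Suc k" n] unit_degree_closed[OF \<eta>, of "Suc k" n] kl n
    by simp
  then show "unit_degree G \<eta> (Suc l) (Suc k) = \<one>"
    using unit_degree_closed[OF \<eta>, of "Suc k" n] unit_degree_closed[OF \<eta>, of "Suc l" "Suc k"] kl
    by (simp add: One_nat_def del: l_one)
qed

end


section \<open>Normal form of the Gram matrix\<close>

text \<open>In blocks, for even \<open>n\<close>: if \<open>V\<close> has upper half \<open>(X, Y)\<close>, this is the matrix with rows
  \<open>(X, Y / 2)\<close> and \<open>(0, 1)\<close>. For odd \<open>n\<close> the middle row is a row of the identity, and above it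
  the middle column keeps the entries of \<open>V\<close>.\<close>

definition half_factor :: "nat \<Rightarrow> 'a::field mat \<Rightarrow> 'a mat" where
  "half_factor n V = mat n n (\<lambda>(k, l).
     if k < n div 2 then (if l < n - n div 2 then V $$ (k, l) else V $$ (k, l) / 2)
     else if k = l then 1 else 0)"

lemma half_factor_UT: "V \<in> UT n \<Longrightarrow> half_factor n V \<in> UT n"
  by (auto simp: UT_iff half_factor_def)

lemma half_factor_carrier [simp]: "half_factor n V \<in> carrier_mat n n"
  by (simp add: half_factor_def)

text \<open>The lower half of \<open>V\<close> is determined by its upper half through the symmetry of \<open>V\<close>. In the
  upper right block the product is \<open>Y / 2 + \<sigma> \<tau> (Y / 2)\<close>, which is \<open>Y\<close> because \<open>\<sigma> \<tau> Y = Y\<close>; this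
  is where \<open>2\<close> has to be invertible.\<close>

lemma half_factor_product:
  fixes V :: "'a::field mat"
  assumes V: "V \<in> UT n" and flip: "canonical_involution n V = \<sigma> \<cdot>\<^sub>m V"
    and \<sigma>: "admissible_sign n \<sigma>" and mid: "odd n \<Longrightarrow> V $$ (n div 2, n div 2) = 1"
    and two: "(2::'a) \<noteq> 0"
  shows "canonical_involution n (half_factor n V) * (half_sign n \<sigma> * half_factor n V) = V"
proof (rule square_mat_eqI[of _ n])
  let ?N = "half_factor n V" and ?m = "n div 2"
  let ?s = "\<lambda>p. if p < n - ?m then 1 else \<sigma>"
  fix k l
  assume kl: "k < n" "l < n"
  have sym: "\<sigma> * V $$ (n - 1 - l, n - 1 - k) = V $$ (k, l)"
  proof -
    have "V $$ (n - 1 - l, n - 1 - k) = \<sigma> * V $$ (k, l)"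
      using arg_cong[OF flip, of "\<lambda>M. M $$ (k, l)"] kl UT_carrier[OF V] by (simp add: flip_entry)
    then show ?thesis
      using \<sigma> by (simp add: admissible_sign_def flip: mult.assoc)
  qed
  let ?a = "if k < ?m then ?N $$ (k, l) else 0"
  let ?b = "if n - ?m \<le> l then \<sigma> * ?N $$ (n - 1 - l, n - 1 - k) else 0"
  let ?c = "if k = l \<and> ?m \<le> k \<and> k < n - ?m then 1 else 0 :: 'a"
  have "(canonical_involution n ?N * (half_sign n \<sigma> * ?N)) $$ (k, l)
      = (\<Sum>p<n. canonical_involution n ?N $$ (k, p) * (half_sign n \<sigma> * ?N) $$ (p, l))"
    using kl by (intro mult_entry) (auto intro!: mult_carrier_mat[of _ n n])
  also have "\<dots> = (\<Sum>p<n. ?N $$ (n - 1 - p, n - 1 - k) * (?s p * ?N $$ (p, l)))"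
    using kl by (intro sum.cong)
      (auto simp: flip_entry half_sign_def mat_diag_mult_left[of _ n n] simp del: index_mult_mat(1))
  \<comment> \<open>For every \<open>p\<close>, one of the two entries of \<open>?N\<close> lies in a row taken from the identity, so only
    \<open>p = k\<close> and \<open>p = l\<close> contribute.\<close>
  also have "\<dots> = (\<Sum>p<n. (if p = k then ?a else 0) + (if p = l then ?b else 0) + (if p = k then ?c else 0))"
  proof (rule sum.cong)
    fix p
    assume "p \<in> {..<n}"
    then have p: "p < n" by simp
    consider "p < ?m" | "?m \<le> p" "p < n - ?m" | "n - ?m \<le> p"
      by linarith
    then show "?N $$ (n - 1 - p, n - 1 - k) * (?s p * ?N $$ (p, l))
        = (if p = k then ?a else 0) + (if p = l then ?b else 0) + (if p = k then ?c else 0)"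
    proof cases
      case 1
      then have "\<not> n - 1 - p < ?m" "p < n - ?m" "n - 1 - p = n - 1 - k \<longleftrightarrow> p = k"
        using p kl by auto
      then show ?thesis
        using 1 p kl by (simp add: half_factor_def)
    next
      case 2
      then have "\<not> n - 1 - p < ?m" "n - 1 - p = n - 1 - k \<longleftrightarrow> p = k"
        using p kl by auto
      then show ?thesis
        using 2 p kl by (auto simp: half_factor_def)
    next
      case 3
      then have "\<not> p < ?m" "\<not> p < n - ?m"
        using p by auto
      then show ?thesis
        using 3 p kl by (auto simp: half_factor_def)
    qed
  qed simp
  also have "\<dots> = ?a + ?b + ?c"
    using kl by (simp add: sum.distrib)
  also have "\<dots> = V $$ (k, l)"
  proof -
    consider "k < ?m" "l < n - ?m" | "k < ?m" "n - ?m \<le> l" | "?m \<le> k" "n - ?m \<le> l"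
      | "?m \<le> k" "l < n - ?m" "k \<noteq> l" | "?m \<le> k" "l < n - ?m" "k = l"
      by linarith
    then show ?thesis
    proof cases
      case 1
      then show ?thesis
        using kl by (simp add: half_factor_def)
    next
      case 2
      then have "n - 1 - l < ?m" "\<not> n - 1 - k < n - ?m" "\<not> l < n - ?m"
        using kl by auto
      then have "?a + ?b + ?c = V $$ (k, l) / 2 + \<sigma> * V $$ (n - 1 - l, n - 1 - k) / 2"
        using 2 kl by (simp add: half_factor_def)
      then show ?thesis
        unfolding sym using two by (simp flip: add_divide_distrib mult_2)
    next
      case 3
      then have "n - 1 - l < ?m" "n - 1 - k < n - ?m" "\<not> l < n - ?m"
        using kl by auto
      then show ?thesis
        using 3 kl by (auto simp: half_factor_def sym simp del: diff_diff_left)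
    next
      case 4
      then have "l < k"
        by linarith
      then show ?thesis
        using 4 kl V by (simp add: UT_lower_entry)
    next
      case 5
      then have "odd n" "k = ?m"
        using kl by (presburger, linarith)
      then show ?thesis
        using 5 kl mid by simp
    qed
  qed
  finally show "(canonical_involution n ?N * (half_sign n \<sigma> * ?N)) $$ (k, l) = V $$ (k, l)" .
qed (use UT_carrier[OF V] in \<open>auto intro!: mult_carrier_mat[of _ n n]\<close>)

lemma half_sign_degree: "half_sign n \<sigma> \<in> homogeneous_component G n \<eta> \<one>\<^bsub>G\<^esub>"
  by (auto simp: homogeneous_component_def UT_iff half_sign_def mat_diag_def unit_degree_refl split: if_splits)

lemma half_factor_degree:
  assumes V: "V \<in> homogeneous_component G n \<eta> \<one>\<^bsub>G\<^esub>"
  shows "half_factor n V \<in> homogeneous_component G n \<eta> \<one>\<^bsub>G\<^esub>"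
proof (rule homogeneous_componentI)
  show "half_factor n V \<in> UT n"
    using V by (intro half_factor_UT homogeneous_componentD(1))
  fix r c
  assume "r \<le> c" "c < n" "half_factor n V $$ (r, c) \<noteq> 0"
  then have "V $$ (r, c) \<noteq> 0 \<or> r = c"
    by (auto simp: half_factor_def split: if_splits)
  then show "unit_degree G \<eta> (Suc r) (Suc c) = \<one>\<^bsub>G\<^esub>"
    using homogeneous_componentD(2)[OF V] \<open>r \<le> c\<close> \<open>c < n\<close> by (auto simp: unit_degree_refl)
qed

lemma (in group) flip_degree_one:
  fixes A :: "'k::field mat"
  assumes \<eta>: "\<eta> \<in> {1..n - 1} \<rightarrow> carrier G"
    and pal: "\<forall>i\<in>{1..n - 1}. \<eta> i = inv (\<eta> (n - i))"
    and A: "A \<in> homogeneous_component G n \<eta> \<one>"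
  shows "canonical_involution n A \<in> homogeneous_component G n \<eta> \<one>"
proof -
  have adm: "admissible_sign n (1 :: 'k)"
    by (simp add: admissible_sign_def)
  have "(canonical_involution n :: 'k mat \<Rightarrow> 'k mat) ` homogeneous_component G n \<eta> \<one>
      \<subseteq> homogeneous_component G n \<eta> (inv \<one>)"
    using twisted_flip_degree_inverting[OF \<eta> pal adm] one_closed
    unfolding degree_inverting_involution_def twisted_flip_one by blast
  with A show ?thesis
    by auto
qed

lemma smult_homogeneous:
  assumes "A \<in> homogeneous_component G n \<eta> g"
  shows "(a::'a::field) \<cdot>\<^sub>m A \<in> homogeneous_component G n \<eta> g"
  using assms by (auto simp: homogeneous_component_def UT_iff)

context degree_inverting
begin

text \<open>Writing the form in the basis given by \<open>N\<close> turns its Gram matrix into \<open>t\<close> times that of a twisted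
  flip, and a scalar factor of the form does not change the adjoint map.\<close>

lemma equivalent_twisted_flip_of_factor:
  assumes \<sigma>: "admissible_sign n \<sigma>"
    and N: "N \<in> homogeneous_component G n \<eta> \<one>" "N' \<in> homogeneous_component G n \<eta> \<one>"
    and inverse: "N * N' = 1\<^sub>m n" "N' * N = 1\<^sub>m n"
    and gram: "gram = t \<cdot>\<^sub>m (canonical_involution n N * (half_sign n \<sigma> * N))" "t \<noteq> 0"
  shows "equivalent_involutions G n \<eta> \<rho> (twisted_flip n \<sigma>)"
proof -
  let ?S = "half_sign n \<sigma>" and ?\<tau> = "canonical_involution n"
  note car = N[THEN homogeneous_componentD(1), THEN UT_carrier]
  have S: "?S * ?S = 1\<^sub>m n"
    using \<sigma> by (simp add: admissible_sign_def half_sign_sq)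
  have \<tau>: "?\<tau> N' * ?\<tau> N = 1\<^sub>m n"
    using car by (simp add: inverse flip_one flip: flip_mult)
  note simps = mult_assoc_square[of _ n] mult_carrier_square car flip_mult[of _ n]
  have "N * \<rho> A * N' = twisted_flip n \<sigma> (N * A * N')" if A: "A \<in> UT n" for A
  proof -
    note car' = UT_carrier[OF A] UT_carrier[OF closed[OF A]]
    have "t \<cdot>\<^sub>m (?\<tau> N * (?S * (N * \<rho> A))) = gram * \<rho> A"
      unfolding gram(1) using car car'
      by (simp add: mult_smult_assoc_mat[of _ n n] simps)
    also have "\<dots> = t \<cdot>\<^sub>m (?\<tau> A * (?\<tau> N * (?S * N)))"
      unfolding gram_image[OF A] unfolding gram(1) using car car'
      by (simp add: mult_smult_distrib[of _ n n _ n] simps)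
    finally have "inverse t \<cdot>\<^sub>m (t \<cdot>\<^sub>m (?\<tau> N * (?S * (N * \<rho> A))))
        = inverse t \<cdot>\<^sub>m (t \<cdot>\<^sub>m (?\<tau> A * (?\<tau> N * (?S * N))))"
      by simp
    then have eq: "?\<tau> N * (?S * (N * \<rho> A)) = ?\<tau> A * (?\<tau> N * (?S * N))"
      using gram(2) by (simp add: smult_smult_mat one_smult_mat)
    have "N * \<rho> A = ?S * (?\<tau> N' * (?\<tau> N * (?S * (N * \<rho> A))))"
      using car car' by (simp add: mult_cancel_inverse[OF \<tau>] mult_cancel_inverse[OF S] simps)
    also have "\<dots> = ?S * (?\<tau> N' * (?\<tau> A * (?\<tau> N * (?S * N))))"
      by (simp only: eq)
    finally have "N * \<rho> A * N' = ?S * (?\<tau> N' * (?\<tau> A * (?\<tau> N * (?S * N)))) * N'"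
      by simp
    then show ?thesis
      using car car' by (simp add: twisted_flip_def inverse right_mult_one_mat[of _ n n] simps)
  qed
  then show ?thesis
    unfolding equivalent_involutions_def
    using conjugation_graded_automorphism[OF \<eta> N inverse] by blast
qed

text \<open>For odd \<open>n\<close> the flip fixes the middle diagonal entry of \<open>gram\<close>, which is nonzero.\<close>

lemma form_sign_admissible: "admissible_sign n form_sign"
  unfolding admissible_sign_def
proof (intro conjI impI)
  assume "odd n"
  then have mid: "n div 2 < n" "n - 1 - n div 2 = n div 2"
    using n by (auto elim!: oddE)
  have "gram $$ (n div 2, n div 2) = form_sign * gram $$ (n div 2, n div 2)"
    using arg_cong[OF flip_gram, of "\<lambda>M. M $$ (n div 2, n div 2)"] mid UT_carrier[OF gram_UT]
    by (simp add: flip_entry)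
  then show "form_sign = 1"
    using gram_diag_nonzero[OF mid(1)] by simp
qed (rule form_sign_sq)

lemma equivalent_twisted_flip:
  assumes two: "(2::'a) \<noteq> 0"
  shows "equivalent_involutions G n \<eta> \<rho> (twisted_flip n form_sign)"
proof -
  let ?mid = "n div 2"
  define t where "t = (if odd n then gram $$ (?mid, ?mid) else 1)"
  have t: "t \<noteq> 0"
    using gram_diag_nonzero[of ?mid] n by (simp add: t_def)
  define V where "V = inverse t \<cdot>\<^sub>m gram"
  note car = UT_carrier[OF gram_UT] UT_carrier[OF gram_inv_UT]
  have V: "V \<in> homogeneous_component G n \<eta> \<one>"
    unfolding V_def by (rule smult_homogeneous[OF gram_degree])
  have flip: "canonical_involution n V = form_sign \<cdot>\<^sub>m V"
    unfolding V_def using car by (simp add: flip_smult flip_gram smult_smult_mat mult.commute)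
  have mid: "V $$ (?mid, ?mid) = 1" if "odd n"
    using that t car n by (simp add: V_def t_def)
  note \<sigma> = form_sign_admissible
  let ?S = "half_sign n form_sign" and ?N = "half_factor n V" and ?\<tau> = "canonical_involution n"
  have fact: "?\<tau> ?N * (?S * ?N) = V"
    using homogeneous_componentD(1)[OF V] flip \<sigma> mid two by (rule half_factor_product)
  \<comment> \<open>The inverse of \<open>?N\<close>, read off from \<open>fact\<close>. In this form it visibly has degree \<open>\<one>\<close>.\<close>
  let ?N' = "(t \<cdot>\<^sub>m gram_inv) * (?\<tau> ?N * ?S)"
  have left: "?N' * ?N = 1\<^sub>m n"
  proof -
    have "?N' * ?N = (t \<cdot>\<^sub>m gram_inv) * V"
      using car by (simp add: mult_assoc_square[of _ n] mult_carrier_square fact)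
    also have "\<dots> = 1\<^sub>m n"
      unfolding V_def using car t
      by (simp add: mult_smult_assoc_mat[of _ n n] mult_smult_distrib[of _ n n] gram_inv_gram smult_smult_mat one_smult_mat)
    finally show ?thesis .
  qed
  have right: "?N * ?N' = 1\<^sub>m n"
    by (rule mat_mult_left_right_inverse[OF _ _ left]) (use car in \<open>auto intro!: mult_carrier_mat[of _ n n]\<close>)
  have N: "?N \<in> homogeneous_component G n \<eta> \<one>"
    by (rule half_factor_degree[OF V])
  note mult_one = homogeneous_component_mult[OF \<eta>, of _ \<one> _ \<one>, simplified]
  have N': "?N' \<in> homogeneous_component G n \<eta> \<one>"
    by (intro mult_one smult_homogeneous gram_inv_degree flip_degree_one[OF \<eta> palindromic] N half_sign_degree)
  have "gram = t \<cdot>\<^sub>m V"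
    unfolding V_def using t by (simp add: smult_smult_mat one_smult_mat)
  then have "gram = t \<cdot>\<^sub>m (?\<tau> ?N * (?S * ?N))"
    unfolding fact .
  then show ?thesis
    using equivalent_twisted_flip_of_factor[OF \<sigma> N N' right left] t by blast
qed

end

section \<open>The classification\<close>

theorem theorem25:
  fixes G :: "('g, 'm) monoid_scheme" and n :: nat and \<eta> :: "nat \<Rightarrow> 'g"
  assumes char: "CHAR('a::field) \<noteq> 2"
    and G: "group G"
    and n: "n \<ge> 1"
    and \<eta>: "\<eta> \<in> {1..n - 1} \<rightarrow> carrier G"
  shows
    "((\<exists>\<rho> :: 'a mat \<Rightarrow> 'a mat. degree_inverting_involution G n \<eta> \<rho>) \<longleftrightarrow>
        (\<forall>i\<in>{1..n - 1}. \<eta> i = inv\<^bsub>G\<^esub> (\<eta> (n - i)))) \<and>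
     ((\<forall>i\<in>{1..n - 1}. \<eta> i = inv\<^bsub>G\<^esub> (\<eta> (n - i))) \<longrightarrow>
        degree_inverting_involution G n \<eta> (canonical_involution n :: 'a mat \<Rightarrow> 'a mat) \<and>
        ((\<exists>m. n = 2 * m \<and>
            degree_inverting_involution G n \<eta> (symplectic_involution m :: 'a mat \<Rightarrow> 'a mat))
          \<longleftrightarrow> even n) \<and>
        (\<forall>\<rho> :: 'a mat \<Rightarrow> 'a mat. degree_inverting_involution G n \<eta> \<rho> \<longrightarrow>
           (equivalent_involutions G n \<eta> \<rho> (canonical_involution n) \<or>
            (\<exists>m. n = 2 * m \<and> equivalent_involutions G n \<eta> \<rho> (symplectic_involution m))) \<and>
           \<not> (equivalent_involutions G n \<eta> \<rho> (canonical_involution n) \<and>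
              (\<exists>m. n = 2 * m \<and> equivalent_involutions G n \<eta> \<rho> (symplectic_involution m)))))"
proof -
  interpret group G by (rule G)
  have n0: "0 < n"
    using n by simp
  have two: "(2::'a) \<noteq> 0"
  proof
    assume "(2::'a) = 0"
    then have "of_nat 2 = (0::'a)"
      by simp
    then have "CHAR('a) dvd 2"
      by (simp only: of_nat_eq_0_iff_char_dvd)
    then have "CHAR('a) = 1 \<or> CHAR('a) = 2"
      using prime_nat_iff two_is_prime_nat by blast
    then show False
      using char of_nat_CHAR[where 'a = 'a] by auto
  qed
  have minus: "(1::'a) \<noteq> - 1"
    using two by (metis add.right_inverse one_add_one)
  have loc: "degree_inverting G n \<rho> \<eta>" if "degree_inverting_involution G n \<eta> \<rho>" for \<rho> :: "'a mat \<Rightarrow> 'a mat"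
    using that G n0 \<eta>
    by (simp add: degree_inverting_def degree_inverting_axioms_def UT_antiinvolution_def
        degree_inverting_involution_def)
  have plus_adm: "admissible_sign n (1::'a)"
    by (simp add: admissible_sign_def)
  have minus_adm: "admissible_sign n (- 1 ::'a)" if "n = 2 * m" for m
    using that by (simp add: admissible_sign_def)
  have sympl: "symplectic_involution m = (twisted_flip n (- 1) :: 'a mat \<Rightarrow> 'a mat)" if "n = 2 * m" for m
    using that by (simp add: twisted_flip_minus_one)
  show ?thesis
  proof (intro conjI impI allI)
    show "(\<exists>\<rho> :: 'a mat \<Rightarrow> 'a mat. degree_inverting_involution G n \<eta> \<rho>) \<longleftrightarrow>
        (\<forall>i\<in>{1..n - 1}. \<eta> i = inv\<^bsub>G\<^esub> (\<eta> (n - i)))"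
      using degree_inverting.palindromic[OF loc] twisted_flip_degree_inverting[OF \<eta> _ plus_adm] by blast
  next
    assume pal: "\<forall>i\<in>{1..n - 1}. \<eta> i = inv\<^bsub>G\<^esub> (\<eta> (n - i))"
    show "degree_inverting_involution G n \<eta> (canonical_involution n :: 'a mat \<Rightarrow> 'a mat)"
      using twisted_flip_degree_inverting[OF \<eta> pal plus_adm] by (simp add: twisted_flip_one)
    show "(\<exists>m. n = 2 * m \<and>
          degree_inverting_involution G n \<eta> (symplectic_involution m :: 'a mat \<Rightarrow> 'a mat))
        \<longleftrightarrow> even n"
      using twisted_flip_degree_inverting[OF \<eta> pal minus_adm] sympl by (metis dvd_def)
  next
    fix \<rho> :: "'a mat \<Rightarrow> 'a mat"
    assume \<rho>: "degree_inverting_involution G n \<eta> \<rho>"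
    interpret degree_inverting G n \<rho> \<eta>
      by (rule loc[OF \<rho>])
    have sign: "form_sign = 1 \<or> form_sign = - 1"
      using form_sign_sq by (simp add: square_eq_1_iff)
    show "equivalent_involutions G n \<eta> \<rho> (canonical_involution n) \<or>
        (\<exists>m. n = 2 * m \<and> equivalent_involutions G n \<eta> \<rho> (symplectic_involution m))"
    proof (cases "form_sign = 1")
      case True
      then show ?thesis
        using equivalent_twisted_flip[OF two] by (simp add: twisted_flip_one)
    next
      case False
      then have "even n"
        using form_sign_admissible by (auto simp: admissible_sign_def)
      then obtain m where m: "n = 2 * m" ..
      then show ?thesis
        using equivalent_twisted_flip[OF two] False sign sympl[OF m] by auto
    qed
    show "\<not> (equivalent_involutions G n \<eta> \<rho> (canonical_involution n) \<and>
        (\<exists>m. n = 2 * m \<and> equivalent_involutions G n \<eta> \<rho> (symplectic_involution m)))"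
    proof
      assume "equivalent_involutions G n \<eta> \<rho> (canonical_involution n) \<and>
        (\<exists>m. n = 2 * m \<and> equivalent_involutions G n \<eta> \<rho> (symplectic_involution m))"
      then obtain m where m: "n = 2 * m"
        and "equivalent_involutions G n \<eta> \<rho> (twisted_flip n 1)"
        and "equivalent_involutions G n \<eta> \<rho> (twisted_flip n (- 1))"
        using sympl by (auto simp: twisted_flip_one)
      then have "form_sign = 1" "form_sign = - 1"
        using equivalent_form_sign[OF UT_antiinvolution_axioms twisted_flip_antiinvolution[OF n0 plus_adm]]
          equivalent_form_sign[OF UT_antiinvolution_axioms twisted_flip_antiinvolution[OF n0 minus_adm[OF m]]]
          twisted_flip_form_sign[OF n0 plus_adm] twisted_flip_form_sign[OF n0 minus_adm[OF m]] by auto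
      with minus show False
        by simp
    qed
  qed
qed

end
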